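(* Let $(\mathscr{A},\mathscr{E})$ be an exact category and let $f:A\to B$ be a morphism in $\mathscr{A}$. Let $P_\bullet$ be a complex $\cdots\to P_2\to P_1\to P_0$ of projective objects with $P_n=0$ for $n<0$, and let $\alpha:P_0\to A$ be a morphism such that the composition $P_1\to P_0\xrightarrow{\alpha}A$ is zero. Let $Q_\bullet\xrightarrow{\beta}B$ be a resolution of $B$ (not necessarily projective). Then there exists a chain map $f_\bullet:P_\bullet\to Q_\bullet$ such that $\beta f_0=f\alpha$, i.e. such that the diagram $$\begin{array}{ccccccccc} \cdots & \to & P_2 & \to & P_1 & \to & P_0 & \xrightarrow{\alpha} & A\\ & & {\scriptstyle f_2}\downarrow & & {\scriptstyle f_1}\downarrow & & {\scriptstyle f_0}\downarrow & & {\scriptstyle f}\downarrow\\ \cdots & \to & Q_2 & \to & Q_1 & \to & Q_0 & \xrightarrow{\beta} & B\end{array}$$ commutes. Moreover, the lift $f_\bullet$ of $f$ is unique up to chain homotopy: if $g_\bullet:P_\bullet\to Q_\bullet$ is another chain map with $\beta g_0=f\alpha$, then $f_\bullet-g_\bullet$ is chain homotopic to zero.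
   Context: A kernel-cokernel pair in an additive category $\mathscr{A}$ is a pair of composable morphisms $A'\xrightarrow{i}A\xrightarrow{p}A''$ such that $i$ is a kernel of $p$ and $p$ is a cokernel of $i$. Given a class $\mathscr{E}$ of kernel-cokernel pairs, an admissible monic is a morphism $i$ for which there is $p$ with $(i,p)\in\mathscr{E}$; an admissible epic is a morphism $p$ for which there is $i$ with $(i,p)\in\mathscr{E}$. An exact structure on $\mathscr{A}$ is a class $\mathscr{E}$ of kernel-cokernel pairs closed under isomorphisms such that: all identity morphisms are admissible monics and admissible epics; admissible monics are closed under composition and admissible epics are closed under composition; the push-out of an admissible monic along an arbitrary morphism exists and yields an admissible monic; the pull-back of an admissible epic along an arbitrary morphism exists and yields an admissible epic. An exact category is a pair $(\mathscr{A},\mathscr{E})$ of an additive category and an exact structure on it; elements of $\mathscr{E}$ are called short exact sequences. An object $P$ is projective if $\mathrm{Hom}_{\mathscr{A}}(P,-):\mathscr{A}\to\mathbf{Ab}$ sends short exact sequences of $\mathscr{E}$ to short exact sequences of abelian groups. A complex is exact (acyclic) if each differential factors as an admissible epic followed by an admissible monic, $X_{n+1}\to Z_n\to X_n$, in such a way that each sequence $Z_n\to X_n\to Z_{n-1}$ is in $\mathscr{E}$. A resolution of $B$ is a complex $Q_\bullet$ with $Q_n=0$ for $n<0$ together with a morphism $\beta:Q_0\to B$ such that the augmented complex $\cdots\to Q_1\to Q_0\xrightarrow{\beta}B\to 0$ is exact (so $\beta$ is an admissible epic). A chain map $h_\bullet:P_\bullet\to Q_\bullet$ is chain homotopic to zero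 if there are morphisms $s_{n+1}:P_n\to Q_{n+1}$ with $h_n=d\,s_{n+1}+s_n\,d$ for all $n$. *)

theory Defs
  imports "HOL-Algebra.Exact_Sequence"
begin

section \<open>Additive categories\<close>

text \<open>
  Morphisms are elements of one type and carry their domain and codomain. Composition is written in
  the usual order: \<open>g \<cdot> f\<close> is ``first \<open>f\<close>, then \<open>g\<close>''. The operations are only
  meaningful on composable, respectively parallel, morphisms.
\<close>

record ('o, 'm) additive_data =
  Obj :: "'o set"
  Mor :: "'m set"
  Dom :: "'m \<Rightarrow> 'o"
  Cod :: "'m \<Rightarrow> 'o"
  id_mor :: "'o \<Rightarrow> 'm"
  comp_mor :: "'m \<Rightarrow> 'm \<Rightarrow> 'm" (infixr \<open>\<cdot>\<index>\<close> 75)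
  add_mor :: "'m \<Rightarrow> 'm \<Rightarrow> 'm" (infixl \<open>\<boxplus>\<index>\<close> 65)
  zero_mor :: "'o \<Rightarrow> 'o \<Rightarrow> 'm"

definition Hom :: "('o, 'm) additive_data \<Rightarrow> 'o \<Rightarrow> 'o \<Rightarrow> 'm set" where
  "Hom C A B = {f \<in> Mor C. Dom C f = A \<and> Cod C f = B}"

text \<open>The morphism group, written multiplicatively as everywhere in the library's group theory.\<close>

definition hom_group :: "('o, 'm) additive_data \<Rightarrow> 'o \<Rightarrow> 'o \<Rightarrow> 'm monoid" where
  "hom_group C A B =
     \<lparr>carrier = Hom C A B, monoid.mult = add_mor C, one = zero_mor C A B\<rparr>"

definition minus_mor :: "('o, 'm) additive_data \<Rightarrow> 'm \<Rightarrow> 'm \<Rightarrow> 'm" where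
  "minus_mor C f g = add_mor C f (inv\<^bsub>hom_group C (Dom C g) (Cod C g)\<^esub> g)"

definition zero_object :: "('o, 'm) additive_data \<Rightarrow> 'o \<Rightarrow> bool" where
  "zero_object C Z \<longleftrightarrow>
     Z \<in> Obj C \<and> (\<forall>A\<in>Obj C. (\<exists>!f. f \<in> Hom C A Z) \<and> (\<exists>!f. f \<in> Hom C Z A))"

locale preadditive_category =
  fixes C :: "('o, 'm) additive_data" (structure)
  assumes Dom_in_Obj: "f \<in> Mor C \<Longrightarrow> Dom C f \<in> Obj C"
    and Cod_in_Obj: "f \<in> Mor C \<Longrightarrow> Cod C f \<in> Obj C"
    and id_in_Hom: "A \<in> Obj C \<Longrightarrow> id_mor C A \<in> Hom C A A"
    and comp_in_Hom: "\<lbrakk>f \<in> Hom C A B; g \<in> Hom C B D\<rbrakk> \<Longrightarrow> g \<cdot> f \<in> Hom C A D"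
    and comp_id: "f \<in> Hom C A B \<Longrightarrow> f \<cdot> id_mor C A = f"
    and id_comp: "f \<in> Hom C A B \<Longrightarrow> id_mor C B \<cdot> f = f"
    and comp_assoc: "\<lbrakk>f \<in> Hom C A B; g \<in> Hom C B D; h \<in> Hom C D F\<rbrakk>
                       \<Longrightarrow> (h \<cdot> g) \<cdot> f = h \<cdot> (g \<cdot> f)"
    and hom_comm_group: "\<lbrakk>A \<in> Obj C; B \<in> Obj C\<rbrakk> \<Longrightarrow> comm_group (hom_group C A B)"
    and comp_add: "\<lbrakk>f \<in> Hom C A B; f' \<in> Hom C A B; g \<in> Hom C B D\<rbrakk>
                     \<Longrightarrow> g \<cdot> (f \<boxplus> f') = (g \<cdot> f) \<boxplus> (g \<cdot> f')"
    and add_comp: "\<lbrakk>f \<in> Hom C A B; g \<in> Hom C B D; g' \<in> Hom C B D\<rbrakk>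
                     \<Longrightarrow> (g \<boxplus> g') \<cdot> f = (g \<cdot> f) \<boxplus> (g' \<cdot> f)"

locale additive_category = preadditive_category +
  assumes zero_object_exists: "\<exists>Z. zero_object C Z"
    and biproduct_exists: "\<lbrakk>A \<in> Obj C; B \<in> Obj C\<rbrakk> \<Longrightarrow>
      \<exists>S i1 i2 p1 p2. i1 \<in> Hom C A S \<and> i2 \<in> Hom C B S \<and> p1 \<in> Hom C S A \<and> p2 \<in> Hom C S B
        \<and> p1 \<cdot> i1 = id_mor C A \<and> p2 \<cdot> i2 = id_mor C B
        \<and> p2 \<cdot> i1 = zero_mor C A B \<and> p1 \<cdot> i2 = zero_mor C B A
        \<and> (i1 \<cdot> p1) \<boxplus> (i2 \<cdot> p2) = id_mor C S"


section \<open>Exact categories\<close>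

definition kernel_of :: "('o, 'm) additive_data \<Rightarrow> 'm \<Rightarrow> 'm \<Rightarrow> bool" where
  "kernel_of C i p \<longleftrightarrow>
     i \<in> Mor C \<and> p \<in> Mor C \<and> Cod C i = Dom C p
     \<and> comp_mor C p i = zero_mor C (Dom C i) (Cod C p)
     \<and> (\<forall>g\<in>Mor C. Cod C g = Dom C p \<longrightarrow> comp_mor C p g = zero_mor C (Dom C g) (Cod C p) \<longrightarrow>
          (\<exists>!h. h \<in> Hom C (Dom C g) (Dom C i) \<and> comp_mor C i h = g))"

definition cokernel_of :: "('o, 'm) additive_data \<Rightarrow> 'm \<Rightarrow> 'm \<Rightarrow> bool" where
  "cokernel_of C p i \<longleftrightarrow>
     i \<in> Mor C \<and> p \<in> Mor C \<and> Cod C i = Dom C p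
     \<and> comp_mor C p i = zero_mor C (Dom C i) (Cod C p)
     \<and> (\<forall>g\<in>Mor C. Dom C g = Cod C i \<longrightarrow> comp_mor C g i = zero_mor C (Dom C i) (Cod C g) \<longrightarrow>
          (\<exists>!h. h \<in> Hom C (Cod C p) (Cod C g) \<and> comp_mor C h p = g))"

definition kernel_cokernel_pair :: "('o, 'm) additive_data \<Rightarrow> 'm \<Rightarrow> 'm \<Rightarrow> bool" where
  "kernel_cokernel_pair C i p \<longleftrightarrow> kernel_of C i p \<and> cokernel_of C p i"

definition isomorphism :: "('o, 'm) additive_data \<Rightarrow> 'o \<Rightarrow> 'o \<Rightarrow> 'm \<Rightarrow> bool" where
  "isomorphism C A B f \<longleftrightarrow>
     f \<in> Hom C A B
     \<and> (\<exists>g\<in>Hom C B A. comp_mor C g f = id_mor C A \<and> comp_mor C f g = id_mor C B)"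

definition isomorphic_pairs :: "('o, 'm) additive_data \<Rightarrow> 'm \<Rightarrow> 'm \<Rightarrow> 'm \<Rightarrow> 'm \<Rightarrow> bool" where
  "isomorphic_pairs C i p i' p' \<longleftrightarrow>
     (\<exists>a b c. isomorphism C (Dom C i) (Dom C i') a
        \<and> isomorphism C (Cod C i) (Cod C i') b
        \<and> isomorphism C (Cod C p) (Cod C p') c
        \<and> comp_mor C b i = comp_mor C i' a \<and> comp_mor C c p = comp_mor C p' b)"

definition admissible_monic :: "('m \<times> 'm) set \<Rightarrow> 'm \<Rightarrow> bool" where
  "admissible_monic E i \<longleftrightarrow> (\<exists>p. (i, p) \<in> E)"

definition admissible_epic :: "('m \<times> 'm) set \<Rightarrow> 'm \<Rightarrow> bool" where
  "admissible_epic E p \<longleftrightarrow> (\<exists>i. (i, p) \<in> E)"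

text \<open>
  \<open>pushout C i f i' f'\<close>: the square with \<open>i : A \<rightarrow> B\<close>, \<open>f : A \<rightarrow> A'\<close>, \<open>i' : A' \<rightarrow> B'\<close>,
  \<open>f' : B \<rightarrow> B'\<close> is a push-out, so \<open>i'\<close> is the push-out of \<open>i\<close> along \<open>f\<close>.
\<close>

definition pushout :: "('o, 'm) additive_data \<Rightarrow> 'm \<Rightarrow> 'm \<Rightarrow> 'm \<Rightarrow> 'm \<Rightarrow> bool" where
  "pushout C i f i' f' \<longleftrightarrow>
     i \<in> Mor C \<and> f \<in> Mor C \<and> i' \<in> Mor C \<and> f' \<in> Mor C
     \<and> Dom C i = Dom C f \<and> Dom C i' = Cod C f \<and> Dom C f' = Cod C i \<and> Cod C i' = Cod C f'
     \<and> comp_mor C i' f = comp_mor C f' i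
     \<and> (\<forall>u\<in>Mor C. \<forall>v\<in>Mor C.
          Dom C u = Cod C f \<longrightarrow> Dom C v = Cod C i \<longrightarrow> Cod C u = Cod C v \<longrightarrow>
          comp_mor C u f = comp_mor C v i \<longrightarrow>
          (\<exists>!h. h \<in> Hom C (Cod C i') (Cod C u) \<and> comp_mor C h i' = u \<and> comp_mor C h f' = v))"

text \<open>
  \<open>pullback C p f p' f'\<close>: the square with \<open>p : B \<rightarrow> D\<close>, \<open>f : D' \<rightarrow> D\<close>, \<open>p' : B' \<rightarrow> D'\<close>,
  \<open>f' : B' \<rightarrow> B\<close> is a pull-back, so \<open>p'\<close> is the pull-back of \<open>p\<close> along \<open>f\<close>.
\<close>

definition pullback :: "('o, 'm) additive_data \<Rightarrow> 'm \<Rightarrow> 'm \<Rightarrow> 'm \<Rightarrow> 'm \<Rightarrow> bool" where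
  "pullback C p f p' f' \<longleftrightarrow>
     p \<in> Mor C \<and> f \<in> Mor C \<and> p' \<in> Mor C \<and> f' \<in> Mor C
     \<and> Cod C p = Cod C f \<and> Cod C p' = Dom C f \<and> Cod C f' = Dom C p \<and> Dom C p' = Dom C f'
     \<and> comp_mor C f p' = comp_mor C p f'
     \<and> (\<forall>u\<in>Mor C. \<forall>v\<in>Mor C.
          Cod C u = Dom C f \<longrightarrow> Cod C v = Dom C p \<longrightarrow> Dom C u = Dom C v \<longrightarrow>
          comp_mor C f u = comp_mor C p v \<longrightarrow>
          (\<exists>!h. h \<in> Hom C (Dom C u) (Dom C p') \<and> comp_mor C p' h = u \<and> comp_mor C f' h = v))"

locale exact_category = additive_category C
  for C :: "('o, 'm) additive_data" (structure) +
  fixes E :: "('m \<times> 'm) set"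
  assumes E_kernel_cokernel: "(i, p) \<in> E \<Longrightarrow> kernel_cokernel_pair C i p"
    and E_iso_closed: "\<lbrakk>(i, p) \<in> E; kernel_cokernel_pair C i' p'; isomorphic_pairs C i p i' p'\<rbrakk>
                         \<Longrightarrow> (i', p') \<in> E"
    and id_monic: "A \<in> Obj C \<Longrightarrow> admissible_monic E (id_mor C A)"
    and id_epic: "A \<in> Obj C \<Longrightarrow> admissible_epic E (id_mor C A)"
    and comp_monic: "\<lbrakk>admissible_monic E i; admissible_monic E j; Cod C i = Dom C j\<rbrakk>
                       \<Longrightarrow> admissible_monic E (j \<cdot> i)"
    and comp_epic: "\<lbrakk>admissible_epic E p; admissible_epic E q; Cod C p = Dom C q\<rbrakk>
                      \<Longrightarrow> admissible_epic E (q \<cdot> p)"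
    and pushout_monic: "\<lbrakk>admissible_monic E i; f \<in> Mor C; Dom C f = Dom C i\<rbrakk>
                          \<Longrightarrow> \<exists>i' f'. pushout C i f i' f' \<and> admissible_monic E i'"
    and pullback_epic: "\<lbrakk>admissible_epic E p; f \<in> Mor C; Cod C f = Cod C p\<rbrakk>
                          \<Longrightarrow> \<exists>p' f'. pullback C p f p' f' \<and> admissible_epic E p'"

text \<open>
  The library's \<open>short_exact_sequence\<close> lists its groups from right to left: the sequence below is
  \<open>0 \<rightarrow> Hom(P, A') \<rightarrow> Hom(P, A) \<rightarrow> Hom(P, A'') \<rightarrow> 0\<close> for \<open>i : A' \<rightarrow> A\<close>, \<open>p : A \<rightarrow> A''\<close>.
\<close>

definition projective_object :: "('o, 'm) additive_data \<Rightarrow> ('m \<times> 'm) set \<Rightarrow> 'o \<Rightarrow> bool" where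
  "projective_object C E P \<longleftrightarrow>
     P \<in> Obj C
     \<and> (\<forall>(i, p)\<in>E. short_exact_sequence
          (hom_group C P (Cod C p)) (hom_group C P (Dom C p)) (hom_group C P (Dom C i))
          (comp_mor C p) (comp_mor C i))"


section \<open>Complexes\<close>

text \<open>Complexes are indexed by all integers; \<open>diff X n\<close> is the differential \<open>X\<^sub>n \<rightarrow> X\<^sub>n\<^sub>-\<^sub>1\<close>.\<close>

record ('o, 'm) complex_data =
  ob :: "int \<Rightarrow> 'o"
  diff :: "int \<Rightarrow> 'm"

definition chain_complex :: "('o, 'm) additive_data \<Rightarrow> ('o, 'm) complex_data \<Rightarrow> bool" where
  "chain_complex C X \<longleftrightarrow>
     (\<forall>n. ob X n \<in> Obj C) \<and> (\<forall>n. diff X n \<in> Hom C (ob X n) (ob X (n - 1)))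
     \<and> (\<forall>n. comp_mor C (diff X n) (diff X (n + 1)) = zero_mor C (ob X (n + 1)) (ob X (n - 1)))"

definition exact_complex ::
  "('o, 'm) additive_data \<Rightarrow> ('m \<times> 'm) set \<Rightarrow> ('o, 'm) complex_data \<Rightarrow> bool" where
  "exact_complex C E X \<longleftrightarrow>
     chain_complex C X
     \<and> (\<exists>Z e m. \<forall>n :: int.
          e n \<in> Hom C (ob X (n + 1)) (Z n) \<and> admissible_epic E (e n)
          \<and> m n \<in> Hom C (Z n) (ob X n) \<and> admissible_monic E (m n)
          \<and> diff X (n + 1) = comp_mor C (m n) (e n)
          \<and> (m n, e (n - 1)) \<in> E)"

text \<open>
  The augmented complex \<open>\<dots> \<rightarrow> Q\<^sub>1 \<rightarrow> Q\<^sub>0 \<rightarrow> B \<rightarrow> 0 \<rightarrow> \<dots>\<close> with \<open>B\<close> in degree \<open>-1\<close>. It is only used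
  when \<open>Q\<^sub>n\<close> is a zero object for \<open>n < 0\<close>, so that its terms below degree \<open>-1\<close> are zero.
\<close>

definition augmented_complex ::
  "('o, 'm) additive_data \<Rightarrow> ('o, 'm) complex_data \<Rightarrow> 'm \<Rightarrow> 'o \<Rightarrow> ('o, 'm) complex_data" where
  "augmented_complex C Q \<beta> B =
     \<lparr>ob = (\<lambda>n. if n = - 1 then B else ob Q n),
      diff = (\<lambda>n. if n = 0 then \<beta> else if n = - 1 then zero_mor C B (ob Q (- 2)) else diff Q n)\<rparr>"

definition resolution ::
  "('o, 'm) additive_data \<Rightarrow> ('m \<times> 'm) set \<Rightarrow> ('o, 'm) complex_data \<Rightarrow> 'm \<Rightarrow> 'o \<Rightarrow> bool" where
  "resolution C E Q \<beta> B \<longleftrightarrow>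
     chain_complex C Q \<and> (\<forall>n<0. zero_object C (ob Q n)) \<and> \<beta> \<in> Hom C (ob Q 0) B
     \<and> exact_complex C E (augmented_complex C Q \<beta> B)"

definition chain_map ::
  "('o, 'm) additive_data \<Rightarrow> ('o, 'm) complex_data \<Rightarrow> ('o, 'm) complex_data \<Rightarrow> (int \<Rightarrow> 'm) \<Rightarrow> bool"
  where
  "chain_map C X Y h \<longleftrightarrow>
     (\<forall>n. h n \<in> Hom C (ob X n) (ob Y n))
     \<and> (\<forall>n. comp_mor C (h (n - 1)) (diff X n) = comp_mor C (diff Y n) (h n))"

text \<open>Here \<open>s n\<close> is a morphism \<open>X\<^sub>n\<^sub>-\<^sub>1 \<rightarrow> Y\<^sub>n\<close>.\<close>

definition homotopic_to_zero ::
  "('o, 'm) additive_data \<Rightarrow> ('o, 'm) complex_data \<Rightarrow> ('o, 'm) complex_data \<Rightarrow> (int \<Rightarrow> 'm) \<Rightarrow> bool"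
  where
  "homotopic_to_zero C X Y h \<longleftrightarrow>
     (\<exists>s. (\<forall>n. s (n + 1) \<in> Hom C (ob X n) (ob Y (n + 1)))
        \<and> (\<forall>n. h n = add_mor C (comp_mor C (diff Y (n + 1)) (s (n + 1)))
                               (comp_mor C (s n) (diff X n))))"

end

theory Submission
  imports Defs
begin

text \<open>
  The comparison theorem rests on one lifting property: a morphism from a projective object into
  the \<open>n\<close>-th term of an exact complex that is killed by the differential factors through the
  kernel \<open>Z\<^sub>n\<close>, and hence lifts along the admissible epic onto \<open>Z\<^sub>n\<close>. Both the lift of \<open>f\<close> and
  the homotopy between two lifts are built degree by degree from this property, applied to the
  augmented resolution.
\<close>

section \<open>Hom-sets, zero objects and morphism groups\<close>

lemma HomD:
  assumes "f \<in> Hom C A B"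
  shows "f \<in> Mor C" "Dom C f = A" "Cod C f = B"
  using assms by (auto simp: Hom_def)

lemma zero_object_uniq_from:
  "\<lbrakk>zero_object C Z; A \<in> Obj C; f \<in> Hom C Z A; g \<in> Hom C Z A\<rbrakk> \<Longrightarrow> f = g"
  unfolding zero_object_def by blast

lemma zero_object_uniq_to:
  "\<lbrakk>zero_object C Z; A \<in> Obj C; f \<in> Hom C A Z; g \<in> Hom C A Z\<rbrakk> \<Longrightarrow> f = g"
  unfolding zero_object_def by blast

lemma hom_group_simps [simp]:
  "carrier (hom_group C A B) = Hom C A B"
  "mult (hom_group C A B) = add_mor C"
  "one (hom_group C A B) = zero_mor C A B"
  by (simp_all add: hom_group_def)

section \<open>Arithmetic, kernels and chain maps in a preadditive category\<close>

context preadditive_category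
begin

lemma Hom_Obj:
  assumes "f \<in> Hom C A B"
  shows "A \<in> Obj C" "B \<in> Obj C"
  using assms Dom_in_Obj Cod_in_Obj by (auto simp: Hom_def)

lemma hom_group_comm_group:
  assumes "f \<in> Hom C A B"
  shows "comm_group (hom_group C A B)"
  using hom_comm_group Hom_Obj[OF assms] by blast

lemma add_in_Hom:
  assumes "f \<in> Hom C A B" "g \<in> Hom C A B"
  shows "f \<boxplus> g \<in> Hom C A B"
proof -
  interpret comm_group "hom_group C A B" by (rule hom_group_comm_group[OF assms(1)])
  show ?thesis using m_closed assms by simp
qed

lemma zero_in_Hom:
  assumes "A \<in> Obj C" "B \<in> Obj C"
  shows "zero_mor C A B \<in> Hom C A B"
proof -
  interpret comm_group "hom_group C A B" by (rule hom_comm_group[OF assms])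
  show ?thesis using one_closed by simp
qed

lemma add_zero:
  assumes "f \<in> Hom C A B"
  shows "f \<boxplus> zero_mor C A B = f"
proof -
  interpret comm_group "hom_group C A B" by (rule hom_group_comm_group[OF assms])
  show ?thesis using r_one assms by simp
qed

lemma zero_add:
  assumes "f \<in> Hom C A B"
  shows "zero_mor C A B \<boxplus> f = f"
proof -
  interpret comm_group "hom_group C A B" by (rule hom_group_comm_group[OF assms])
  show ?thesis using l_one assms by simp
qed

lemma add_right_cancel:
  assumes "f \<in> Hom C A B" "g \<in> Hom C A B" "h \<in> Hom C A B" "f \<boxplus> h = g \<boxplus> h"
  shows "f = g"
proof -
  interpret comm_group "hom_group C A B" by (rule hom_group_comm_group[OF assms(1)])
  show ?thesis using right_cancel[of h f g] assms by simp
qed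

lemma minus_in_Hom:
  assumes "f \<in> Hom C A B" "g \<in> Hom C A B"
  shows "minus_mor C f g \<in> Hom C A B"
proof -
  interpret comm_group "hom_group C A B" by (rule hom_group_comm_group[OF assms(1)])
  show ?thesis
    using m_closed inv_closed assms HomD[OF assms(2)] by (simp add: minus_mor_def)
qed

text \<open>This identity is the working description of a difference: equations about
  \<open>minus_mor\<close> are proved below by adding the subtrahend to both sides and then using
  \<open>add_right_cancel\<close>.\<close>

lemma minus_add_cancel:
  assumes "f \<in> Hom C A B" "g \<in> Hom C A B"
  shows "minus_mor C f g \<boxplus> g = f"
proof -
  interpret comm_group "hom_group C A B" by (rule hom_group_comm_group[OF assms(1)])
  show ?thesis
    using m_assoc[of f "inv\<^bsub>hom_group C A B\<^esub> g" g] l_inv[of g] r_one[of f] inv_closed[of g]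
      assms HomD[OF assms(2)]
    by (simp add: minus_mor_def)
qed

lemma comp_zero:
  assumes "g \<in> Hom C B D" "A \<in> Obj C"
  shows "g \<cdot> zero_mor C A B = zero_mor C A D"
proof -
  have z: "zero_mor C A B \<in> Hom C A B" "zero_mor C A D \<in> Hom C A D"
    using assms Hom_Obj zero_in_Hom by blast+
  have gz: "g \<cdot> zero_mor C A B \<in> Hom C A D"
    using comp_in_Hom z(1) assms(1) by blast
  have "g \<cdot> zero_mor C A B \<boxplus> g \<cdot> zero_mor C A B = zero_mor C A D \<boxplus> g \<cdot> zero_mor C A B"
    using comp_add[OF z(1) z(1) assms(1)] by (simp add: add_zero[OF z(1)] zero_add[OF gz])
  then show ?thesis using add_right_cancel gz z(2) by blast
qed

lemma zero_comp:
  assumes "f \<in> Hom C A B" "D \<in> Obj C"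
  shows "zero_mor C B D \<cdot> f = zero_mor C A D"
proof -
  have z: "zero_mor C B D \<in> Hom C B D" "zero_mor C A D \<in> Hom C A D"
    using assms Hom_Obj zero_in_Hom by blast+
  have zf: "zero_mor C B D \<cdot> f \<in> Hom C A D"
    using comp_in_Hom z(1) assms(1) by blast
  have "zero_mor C B D \<cdot> f \<boxplus> zero_mor C B D \<cdot> f = zero_mor C A D \<boxplus> zero_mor C B D \<cdot> f"
    using add_comp[OF assms(1) z(1) z(1)] by (simp add: add_zero[OF z(1)] zero_add[OF zf])
  then show ?thesis using add_right_cancel zf z(2) by blast
qed

lemma kernel_of_factor:
  assumes "kernel_of C i p" "g \<in> Hom C A (Dom C p)" "p \<cdot> g = zero_mor C A (Cod C p)"
  obtains h where "h \<in> Hom C A (Dom C i)" "i \<cdot> h = g"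
  using assms unfolding kernel_of_def Hom_def by blast

text \<open>Both \<open>g\<close> and the zero morphism are factorizations of zero through
  \<open>i\<close>, and the universal property allows only one.\<close>

lemma kernel_of_monic:
  assumes "kernel_of C i p" "g \<in> Hom C A (Dom C i)" "i \<cdot> g = zero_mor C A (Cod C i)"
  shows "g = zero_mor C A (Dom C i)"
proof -
  have i: "i \<in> Hom C (Dom C i) (Cod C i)" and p: "p \<in> Hom C (Cod C i) (Cod C p)"
    using assms(1) by (auto simp: kernel_of_def Hom_def)
  have A: "A \<in> Obj C" using Hom_Obj assms(2) by blast
  have z: "zero_mor C A (Cod C i) \<in> Hom C A (Cod C i)"
    "zero_mor C A (Dom C i) \<in> Hom C A (Dom C i)"
    using zero_in_Hom A Hom_Obj[OF i] by blast+
  have "\<exists>!h. h \<in> Hom C A (Dom C i) \<and> i \<cdot> h = zero_mor C A (Cod C i)"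
    using assms(1) HomD[OF z(1)] HomD[OF p] comp_zero[OF p A] unfolding kernel_of_def by metis
  then show ?thesis using assms z(2) comp_zero[OF i A] by blast
qed

text \<open>After adding \<open>G (n - 1) \<cdot> diff X n\<close>, which equals
  \<open>diff Y n \<cdot> G n\<close>, distributivity turns the required square into the one for
  \<open>F\<close>.\<close>

lemma chain_map_minus:
  assumes X: "chain_complex C X" and Y: "chain_complex C Y"
    and F: "chain_map C X Y F" and G: "chain_map C X Y G"
  shows "chain_map C X Y (\<lambda>n. minus_mor C (F n) (G n))"
proof -
  have dX: "diff X n \<in> Hom C (ob X n) (ob X (n - 1))"
    and dY: "diff Y n \<in> Hom C (ob Y n) (ob Y (n - 1))"
    and Fn: "F n \<in> Hom C (ob X n) (ob Y n)" and Gn: "G n \<in> Hom C (ob X n) (ob Y n)"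
    and Fd: "F (n - 1) \<cdot> diff X n = diff Y n \<cdot> F n"
    and Gd: "G (n - 1) \<cdot> diff X n = diff Y n \<cdot> G n" for n
    using X Y F G by (auto simp: chain_complex_def chain_map_def)
  have H: "minus_mor C (F n) (G n) \<in> Hom C (ob X n) (ob Y n)" for n
    using minus_in_Hom Fn Gn by blast
  have "minus_mor C (F (n - 1)) (G (n - 1)) \<cdot> diff X n = diff Y n \<cdot> minus_mor C (F n) (G n)" for n
  proof (rule add_right_cancel)
    show "minus_mor C (F (n - 1)) (G (n - 1)) \<cdot> diff X n \<boxplus> G (n - 1) \<cdot> diff X n
        = diff Y n \<cdot> minus_mor C (F n) (G n) \<boxplus> G (n - 1) \<cdot> diff X n"
      using add_comp[OF dX H Gn, symmetric] comp_add[OF H Gn dY, symmetric]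
      by (simp add: Fd Gd minus_add_cancel[OF Fn Gn])
  qed (use comp_in_Hom H Gn dX dY in blast)+
  then show ?thesis using H by (simp add: chain_map_def)
qed

end

section \<open>Lifting from projective objects in an exact category\<close>

context exact_category
begin

text \<open>Exactness of the sequence of Hom groups at its right end says that composition with
  \<open>p\<close> is onto.\<close>

lemma projective_lift:
  assumes "projective_object C E P" "admissible_epic E p" "g \<in> Hom C P (Cod C p)"
  obtains h where "h \<in> Hom C P (Dom C p)" "p \<cdot> h = g"
proof -
  obtain i where "(i, p) \<in> E" using assms(2) unfolding admissible_epic_def by blast
  then have "short_exact_sequence
      (hom_group C P (Cod C p)) (hom_group C P (Dom C p)) (hom_group C P (Dom C i))
      (comp_mor C p) (comp_mor C i)"
    using assms(1) unfolding projective_object_def by blast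
  then have "Hom C P (Cod C p) \<subseteq> comp_mor C p ` Hom C P (Dom C p)"
    by (auto simp: short_exact_sequence_iff epi_iff_subset)
  then show thesis using assms(3) that by blast
qed

lemma exact_complex_lift:
  assumes X: "exact_complex C E X" and P: "projective_object C E P"
    and g: "g \<in> Hom C P (ob X n)" and dg: "diff X n \<cdot> g = zero_mor C P (ob X (n - 1))"
  obtains h where "h \<in> Hom C P (ob X (n + 1))" "diff X (n + 1) \<cdot> h = g"
proof -
  obtain Z e m where e: "\<And>n. e n \<in> Hom C (ob X (n + 1)) (Z n)"
    and epi: "\<And>n. admissible_epic E (e n)"
    and m: "\<And>n. m n \<in> Hom C (Z n) (ob X n)"
    and d: "\<And>n. diff X (n + 1) = m n \<cdot> e n" and ex: "\<And>n. (m n, e (n - 1)) \<in> E"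
    using X unfolding exact_complex_def by blast
  have e': "e (n - 1) \<in> Hom C (ob X n) (Z (n - 1))" and d': "diff X n = m (n - 1) \<cdot> e (n - 1)"
    using e[of "n - 1"] d[of "n - 1"] by simp_all
  have ker: "kernel_of C (m k) (e (k - 1))" for k
    using E_kernel_cokernel[OF ex] by (simp add: kernel_cokernel_pair_def)
  \<comment> \<open>The differential is \<open>m (n - 1)\<close> after \<open>e (n - 1)\<close>;
    since \<open>m (n - 1)\<close> is a kernel, hence monic, \<open>g\<close> is already killed by
    \<open>e (n - 1)\<close>, whose kernel is \<open>m n\<close>.\<close>
  have "e (n - 1) \<cdot> g = zero_mor C P (Z (n - 1))"
    using kernel_of_monic[OF ker[of "n - 1"], of "e (n - 1) \<cdot> g" P] comp_in_Hom[OF g e']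
      comp_assoc[OF g e' m] dg HomD[OF m[of "n - 1"]] by (simp add: d')
  then obtain k where k: "k \<in> Hom C P (Z n)" "m n \<cdot> k = g"
    using kernel_of_factor[OF ker[of n], of g P] g HomD[OF e'] HomD[OF m[of n]] by auto
  obtain h where h: "h \<in> Hom C P (ob X (n + 1))" "e n \<cdot> h = k"
    using projective_lift[OF P epi[of n], of k] k(1) HomD[OF e[of n]] by auto
  have "diff X (n + 1) \<cdot> h = g"
    using comp_assoc[OF h(1) e m] d h(2) k(2) by simp
  then show thesis using that h(1) by blast
qed

section \<open>Lifting along a resolution, by degree\<close>

context
  fixes Q \<beta> B
  assumes Q: "resolution C E Q \<beta> B"
begin

text \<open>This is degree -1 of the augmented complex. The differential leaving B is zero, so every
  \<open>g\<close> satisfies the cycle condition.\<close>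

lemma resolution_lift_augmentation:
  assumes P: "projective_object C E P" and g: "g \<in> Hom C P B"
  obtains h where "h \<in> Hom C P (ob Q 0)" "\<beta> \<cdot> h = g"
proof -
  have "ob Q (- 2) \<in> Obj C" using Q by (auto simp: resolution_def chain_complex_def)
  then have "zero_mor C B (ob Q (- 2)) \<cdot> g = zero_mor C P (ob Q (- 2))"
    using zero_comp g by blast
  then show thesis
    using exact_complex_lift[of "augmented_complex C Q \<beta> B" P g "- 1" thesis] Q P g that
    by (simp add: resolution_def augmented_complex_def)
qed

text \<open>Degree 0 is separate because there the outgoing differential of the augmented complex is
  \<beta>, not \<open>diff Q 0\<close>.\<close>

lemma resolution_lift_0:
  assumes P: "projective_object C E P" and g: "g \<in> Hom C P (ob Q 0)" "\<beta> \<cdot> g = zero_mor C P B"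
  obtains h where "h \<in> Hom C P (ob Q 1)" "diff Q 1 \<cdot> h = g"
  using exact_complex_lift[of "augmented_complex C Q \<beta> B" P g 0 thesis] Q P g that
  by (simp add: resolution_def augmented_complex_def)

lemma resolution_lift_pos:
  assumes P: "projective_object C E P" and n: "n > 0" and g: "g \<in> Hom C P (ob Q n)"
    and dg: "diff Q n \<cdot> g = zero_mor C P (ob Q (n - 1))"
  obtains h where "h \<in> Hom C P (ob Q (n + 1))" "diff Q (n + 1) \<cdot> h = g"
  using exact_complex_lift[of "augmented_complex C Q \<beta> B" P g n thesis] Q P n g dg that
  by (simp add: resolution_def augmented_complex_def)

section \<open>Existence and uniqueness of lifts of chain maps\<close>

context
  fixes P
  assumes P: "chain_complex C P"
    and proj: "\<And>n. projective_object C E (ob P n)"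
    and P_neg: "\<And>n. n < 0 \<Longrightarrow> zero_object C (ob P n)"
begin

private lemma obP: "ob P n \<in> Obj C"
  and dP: "diff P n \<in> Hom C (ob P n) (ob P (n - 1))"
  and ddP: "diff P n \<cdot> diff P (n + 1) = zero_mor C (ob P (n + 1)) (ob P (n - 1))"
  using P by (auto simp: chain_complex_def)

private lemma obQ: "ob Q n \<in> Obj C"
  and dQ: "diff Q n \<in> Hom C (ob Q n) (ob Q (n - 1))"
  and augQ: "\<beta> \<in> Hom C (ob Q 0) B"
  using Q by (auto simp: resolution_def chain_complex_def)

private lemma dP_Suc: "diff P (n + 1) \<in> Hom C (ob P (n + 1)) (ob P n)"
  and dQ_Suc: "diff Q (n + 1) \<in> Hom C (ob Q (n + 1)) (ob Q n)"
  using dP[of "n + 1"] dQ[of "n + 1"] by simp_all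

text \<open>Supplies the vanishing that re-establishes the invariant in both recursions
  below.\<close>

private lemma comp_ddP:
  assumes x: "x \<in> Hom C (ob P n) D"
  shows "(x \<cdot> diff P (n + 1)) \<cdot> diff P (n + 1 + 1) = zero_mor C (ob P (n + 1 + 1)) D"
proof -
  have "diff P (n + 1) \<cdot> diff P (n + 1 + 1) = zero_mor C (ob P (n + 1 + 1)) (ob P n)"
    using ddP[of "n + 1"] by simp
  then show ?thesis using comp_assoc[OF dP_Suc dP_Suc x] comp_zero[OF x obP] by simp
qed

lemma chain_map_lift_exists:
  assumes g: "g \<in> Hom C (ob P 0) B" and gd: "g \<cdot> diff P 1 = zero_mor C (ob P 1) B"
  shows "\<exists>F. chain_map C P Q F \<and> \<beta> \<cdot> F 0 = g"
proof -
  \<comment> \<open>The invariant carries the condition under which the next lift exists. In degree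
    0 it records the equation with \<beta> instead, from which that condition follows by
    \<open>gd\<close>.\<close>
  let ?Inv = "\<lambda>n x. x \<in> Hom C (ob P (int n)) (ob Q (int n)) \<and> (n = 0 \<longrightarrow> \<beta> \<cdot> x = g)
    \<and> (n > 0 \<longrightarrow> diff Q (int n) \<cdot> (x \<cdot> diff P (int n + 1)) = zero_mor C (ob P (int n + 1)) (ob Q (int n - 1)))"
  let ?Step = "\<lambda>n x y. x \<cdot> diff P (int n + 1) = diff Q (int n + 1) \<cdot> y"
  have "\<exists>F. \<forall>n. ?Inv n (F n) \<and> ?Step n (F n) (F (Suc n))"
  proof (rule dependent_nat_choice)
    show "\<exists>x. ?Inv 0 x"
      using resolution_lift_augmentation[OF proj g] by auto
  next
    fix x n
    assume x: "?Inv n x"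
    then have xd: "x \<cdot> diff P (int n + 1) \<in> Hom C (ob P (int n + 1)) (ob Q (int n))"
      using comp_in_Hom dP_Suc by blast
    obtain y where y: "y \<in> Hom C (ob P (int n + 1)) (ob Q (int n + 1))"
      "diff Q (int n + 1) \<cdot> y = x \<cdot> diff P (int n + 1)"
    proof (cases "n = 0")
      case True
      have "\<beta> \<cdot> (x \<cdot> diff P 1) = zero_mor C (ob P 1) B"
        using comp_assoc[of "diff P 1" "ob P 1" "ob P 0" x "ob Q 0" \<beta> B] dP_Suc[of 0] x True gd augQ
        by simp
      then show thesis
        using resolution_lift_0[OF proj[of 1], of "x \<cdot> diff P 1"] xd True that by auto
    next
      case False
      then show thesis
        using resolution_lift_pos[OF proj _ xd] x that by auto
    qed
    \<comment> \<open>The new component satisfies the cycle condition because moving the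
      differential across it produces two consecutive differentials of P.\<close>
    have "diff Q (int n + 1) \<cdot> (y \<cdot> diff P (int n + 1 + 1))
        = (x \<cdot> diff P (int n + 1)) \<cdot> diff P (int n + 1 + 1)"
      using comp_assoc[OF dP_Suc y(1) dQ_Suc] y(2) by simp
    also have "\<dots> = zero_mor C (ob P (int n + 1 + 1)) (ob Q (int n))"
      using comp_ddP x by blast
    finally have "?Inv (Suc n) y" using y(1) by (simp add: add.commute)
    then show "\<exists>y. ?Inv (Suc n) y \<and> ?Step n x y" using y(2) by auto
  qed
  then obtain F where F: "\<And>n. ?Inv n (F n)" and FS: "\<And>n. ?Step n (F n) (F (Suc n))" by blast
  \<comment> \<open>The recursion runs over natural numbers; zero morphisms fill the negative
    degrees.\<close>
  define F' where "F' n = (if n < 0 then zero_mor C (ob P n) (ob Q n) else F (nat n))" for n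
  have F': "F' n \<in> Hom C (ob P n) (ob Q n)" for n
    using F[of "nat n"] zero_in_Hom obP obQ by (auto simp: F'_def)
  have "F' (n - 1) \<cdot> diff P n = diff Q n \<cdot> F' n" for n
  proof (cases "n > 0")
    case True
    then obtain k where n: "n = int k + 1" using that[of "nat (n - 1)"] by simp
    show ?thesis using FS[of k] by (simp add: F'_def n nat_add_distrib)
  next
    case False
    \<comment> \<open>This case includes n = 0: the square from degree 0 to degree -1 commutes
      because it ends in a zero object.\<close>
    then have "zero_object C (ob Q (n - 1))" using Q by (simp add: resolution_def)
    then show ?thesis
      by (rule zero_object_uniq_to[OF _ obP comp_in_Hom[OF dP F'] comp_in_Hom[OF F' dQ]])
  qed
  then have "chain_map C P Q F'" using F' by (simp add: chain_map_def)
  moreover have "\<beta> \<cdot> F' 0 = g" using F[of 0] by (simp add: F'_def)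
  ultimately show ?thesis by blast
qed

text \<open>The homotopy is built recursively: \<open>t 0\<close> lifts \<open>H 0\<close>, which
  \<beta> kills, and each later term lifts the part of H that the previous term leaves
  uncovered.\<close>

lemma chain_map_null_homotopic:
  assumes H: "chain_map C P Q H" and H0: "\<beta> \<cdot> H 0 = zero_mor C (ob P 0) B"
  shows "homotopic_to_zero C P Q H"
proof -
  have Hn: "H n \<in> Hom C (ob P n) (ob Q n)"
    and Hd: "H (n - 1) \<cdot> diff P n = diff Q n \<cdot> H n" for n
    using H by (auto simp: chain_map_def)
  \<comment> \<open>The homotopy equation in degree n also involves the preceding term. Composing it
    with \<open>diff P (int n + 1)\<close> kills that contribution, so the invariant can speak of a
    single term.\<close>
  let ?Inv = "\<lambda>n x. x \<in> Hom C (ob P (int n)) (ob Q (int n + 1))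
    \<and> (diff Q (int n + 1) \<cdot> x) \<cdot> diff P (int n + 1) = H (int n) \<cdot> diff P (int n + 1)
    \<and> (n = 0 \<longrightarrow> diff Q 1 \<cdot> x = H 0)"
  let ?Step = "\<lambda>n x y. diff Q (int n + 1 + 1) \<cdot> y \<boxplus> x \<cdot> diff P (int n + 1) = H (int n + 1)"
  have "\<exists>t. \<forall>n. ?Inv n (t n) \<and> ?Step n (t n) (t (Suc n))"
  proof (rule dependent_nat_choice)
    show "\<exists>x. ?Inv 0 x"
      using resolution_lift_0[OF proj Hn H0] by (metis add_0 of_nat_0)
  next
    fix x n
    assume x: "?Inv n x"
    let ?P1 = "ob P (int n + 1)" and ?d1 = "diff P (int n + 1)"
    let ?P2 = "ob P (int n + 1 + 1)" and ?d2 = "diff P (int n + 1 + 1)"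
    have xd: "x \<cdot> ?d1 \<in> Hom C ?P1 (ob Q (int n + 1))"
      using comp_in_Hom dP_Suc x by blast
    \<comment> \<open>The homotopy equation forces the next term to be a lift of \<open>r\<close>;
      the invariant together with the chain map equation for H makes \<open>r\<close> a
      cycle.\<close>
    define r where "r = minus_mor C (H (int n + 1)) (x \<cdot> ?d1)"
    have r: "r \<in> Hom C ?P1 (ob Q (int n + 1))" "r \<boxplus> x \<cdot> ?d1 = H (int n + 1)"
      unfolding r_def using minus_in_Hom minus_add_cancel Hn xd by blast+
    have dr: "diff Q (int n + 1) \<cdot> r \<in> Hom C ?P1 (ob Q (int n))"
      using comp_in_Hom[OF r(1) dQ_Suc] .
    have dxd: "diff Q (int n + 1) \<cdot> (x \<cdot> ?d1) \<in> Hom C ?P1 (ob Q (int n))"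
      using comp_in_Hom[OF xd dQ_Suc] .
    have "diff Q (int n + 1) \<cdot> r = zero_mor C ?P1 (ob Q (int n))"
    proof (rule add_right_cancel[OF dr _ dxd])
      show "zero_mor C ?P1 (ob Q (int n)) \<in> Hom C ?P1 (ob Q (int n))"
        using zero_in_Hom obP obQ by blast
      have "diff Q (int n + 1) \<cdot> r \<boxplus> diff Q (int n + 1) \<cdot> (x \<cdot> ?d1) = diff Q (int n + 1) \<cdot> H (int n + 1)"
        using comp_add[OF r(1) xd dQ_Suc] r(2) by simp
      also have "\<dots> = H (int n) \<cdot> ?d1" using Hd[of "int n + 1"] by simp
      also have "\<dots> = diff Q (int n + 1) \<cdot> (x \<cdot> ?d1)"
        using x comp_assoc[OF dP_Suc conjunct1[OF x] dQ_Suc] by simp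
      finally show "diff Q (int n + 1) \<cdot> r \<boxplus> diff Q (int n + 1) \<cdot> (x \<cdot> ?d1)
          = zero_mor C ?P1 (ob Q (int n)) \<boxplus> diff Q (int n + 1) \<cdot> (x \<cdot> ?d1)"
        using zero_add[OF dxd] by simp
    qed
    then obtain y where y: "y \<in> Hom C ?P1 (ob Q (int n + 1 + 1))" "diff Q (int n + 1 + 1) \<cdot> y = r"
      using resolution_lift_pos[OF proj _ r(1)] by auto
    have rd: "r \<cdot> ?d2 \<in> Hom C ?P2 (ob Q (int n + 1))"
      using comp_in_Hom[OF dP_Suc r(1)] .
    \<comment> \<open>The invariant in the next degree: the correction by \<open>x\<close> dies
      against two consecutive differentials.\<close>
    have "H (int n + 1) \<cdot> ?d2 = r \<cdot> ?d2 \<boxplus> (x \<cdot> ?d1) \<cdot> ?d2"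
      using add_comp[OF dP_Suc r(1) xd] r(2) by simp
    also have "(x \<cdot> ?d1) \<cdot> ?d2 = zero_mor C ?P2 (ob Q (int n + 1))"
      using comp_ddP x by blast
    also have "r \<cdot> ?d2 \<boxplus> \<dots> = r \<cdot> ?d2" by (rule add_zero[OF rd])
    finally have "?Inv (Suc n) y" using y by (simp add: add.commute)
    then show "\<exists>y. ?Inv (Suc n) y \<and> ?Step n x y" using y(2) r(2) by blast
  qed
  then obtain t where t: "\<And>n. ?Inv n (t n)" and tS: "\<And>n. ?Step n (t n) (t (Suc n))" by blast
  \<comment> \<open>Index shift: \<open>s n\<close> starts at degree n - 1, so it is the recursive
    term with index n - 1, and zero when that index is negative.\<close>
  define s where
    "s n = (if n \<le> 0 then zero_mor C (ob P (n - 1)) (ob Q n) else t (nat (n - 1)))" for n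
  have s: "s (n + 1) \<in> Hom C (ob P n) (ob Q (n + 1))" for n
    using t[of "nat n"] zero_in_Hom obP obQ by (auto simp: s_def)
  have s': "s n \<in> Hom C (ob P (n - 1)) (ob Q n)" for n
    using s[of "n - 1"] by simp
  have "H n = diff Q (n + 1) \<cdot> s (n + 1) \<boxplus> s n \<cdot> diff P n" for n
  proof -
    have ds: "diff Q (n + 1) \<cdot> s (n + 1) \<in> Hom C (ob P n) (ob Q n)"
      using comp_in_Hom[OF s dQ_Suc] .
    have sd: "s n \<cdot> diff P n \<in> Hom C (ob P n) (ob Q n)"
      using comp_in_Hom[OF dP s'] .
    \<comment> \<open>Below degree 0 the source is a zero object. In degree 0 the summand with
      \<open>s 0\<close> vanishes and the base clause of the invariant remains. Above, the recursion
      step applies.\<close>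
    consider "n < 0" | "n = 0" | "n > 0" by linarith
    then show ?thesis
    proof cases
      case 1
      then show ?thesis
        by (rule zero_object_uniq_from[OF P_neg obQ Hn add_in_Hom[OF ds sd]])
    next
      case 2
      then have "s n = zero_mor C (ob P (n - 1)) (ob Q n)" by (simp add: s_def)
      then have "s n \<cdot> diff P n = zero_mor C (ob P n) (ob Q n)"
        using zero_comp[OF dP obQ] by simp
      then show ?thesis using add_zero[OF ds] t[of 0] 2 by (simp add: s_def)
    next
      case 3
      then have "nat n = Suc (nat (n - 1))" "int (nat (n - 1)) + 1 = n" by auto
      then show ?thesis using tS[of "nat (n - 1)"] 3 by (simp add: s_def)
    qed
  qed
  then show ?thesis unfolding homotopic_to_zero_def using s by blast
qed

text \<open>The difference is a chain map whose degree 0 component is killed by \<beta>, so the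
  preceding lemma makes it null homotopic.\<close>

lemma chain_map_lift_unique:
  assumes F: "chain_map C P Q F" and G: "chain_map C P Q G" and FG: "\<beta> \<cdot> F 0 = \<beta> \<cdot> G 0"
  shows "homotopic_to_zero C P Q (\<lambda>n. minus_mor C (F n) (G n))"
proof (rule chain_map_null_homotopic)
  show "chain_map C P Q (\<lambda>n. minus_mor C (F n) (G n))"
    using chain_map_minus P Q F G by (simp add: resolution_def)
  have F0: "F 0 \<in> Hom C (ob P 0) (ob Q 0)" and G0: "G 0 \<in> Hom C (ob P 0) (ob Q 0)"
    using F G by (auto simp: chain_map_def)
  let ?H = "minus_mor C (F 0) (G 0)"
  have H: "?H \<in> Hom C (ob P 0) (ob Q 0)" using minus_in_Hom F0 G0 by blast
  have bG: "\<beta> \<cdot> G 0 \<in> Hom C (ob P 0) B" using comp_in_Hom[OF G0 augQ] .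
  show "\<beta> \<cdot> ?H = zero_mor C (ob P 0) B"
  proof (rule add_right_cancel[OF comp_in_Hom[OF H augQ] _ bG])
    show "zero_mor C (ob P 0) B \<in> Hom C (ob P 0) B"
      using zero_in_Hom Hom_Obj[OF bG] by blast
    show "\<beta> \<cdot> ?H \<boxplus> \<beta> \<cdot> G 0 = zero_mor C (ob P 0) B \<boxplus> \<beta> \<cdot> G 0"
      using comp_add[OF H G0 augQ] minus_add_cancel[OF F0 G0] zero_add[OF bG] FG by simp
  qed
qed

end

end

end

section \<open>The comparison theorem\<close>

theorem theorem12p4:
  fixes C :: "('o, 'm) additive_data" and E :: "('m \<times> 'm) set"
    and P Q :: "('o, 'm) complex_data" and A B :: 'o and f \<alpha> \<beta> :: 'm
  assumes "exact_category C E"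
    and "f \<in> Hom C A B"
    and "chain_complex C P"
    and "\<forall>n. projective_object C E (ob P n)"
    and "\<forall>n<0. zero_object C (ob P n)"
    and "\<alpha> \<in> Hom C (ob P 0) A"
    and "comp_mor C \<alpha> (diff P 1) = zero_mor C (ob P 1) A"
    and "resolution C E Q \<beta> B"
  shows "(\<exists>F. chain_map C P Q F \<and> comp_mor C \<beta> (F 0) = comp_mor C f \<alpha>)
    \<and> (\<forall>F G. chain_map C P Q F \<longrightarrow> comp_mor C \<beta> (F 0) = comp_mor C f \<alpha> \<longrightarrow>
          chain_map C P Q G \<longrightarrow> comp_mor C \<beta> (G 0) = comp_mor C f \<alpha> \<longrightarrow>
          homotopic_to_zero C P Q (\<lambda>n. minus_mor C (F n) (G n)))"
proof -
  interpret exact_category C E by fact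
  have "diff P 1 \<in> Hom C (ob P 1) (ob P (1 - 1))"
    using assms(3) unfolding chain_complex_def by blast
  then have dP: "diff P 1 \<in> Hom C (ob P 1) (ob P 0)" by simp
  have P1: "ob P 1 \<in> Obj C" using assms(3) by (simp add: chain_complex_def)
  \<comment> \<open>The composite of \<alpha> and \<open>f\<close> plays the role of
    \<open>g\<close> in the existence lemma; it kills \<open>diff P 1\<close> because \<alpha>
    does.\<close>
  have f\<alpha>: "comp_mor C f \<alpha> \<in> Hom C (ob P 0) B"
    using comp_in_Hom assms(2,6) by blast
  have f\<alpha>d: "comp_mor C (comp_mor C f \<alpha>) (diff P 1) = zero_mor C (ob P 1) B"
    using comp_assoc[OF dP assms(6,2)] assms(7) comp_zero[OF assms(2) P1] by simp
  show ?thesis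
    using chain_map_lift_exists[OF assms(8,3) _ _ f\<alpha> f\<alpha>d]
      chain_map_lift_unique[OF assms(8,3)] assms(4,5)
    by simp
qed

end
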